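(* Let $X$ be an infinite-dimensional Banach space (real or complex). Then the unit sphere of $X$ contains a symmetrically $(1+)$-separated sequence; that is, there is a sequence $(x_n)_{n=1}^\infty$ in $X$ with $\|x_n\|=1$ for all $n$ and $\|x_n+x_k\|>1$ and $\|x_n-x_k\|>1$ for all $n\neq k$.
   Context: For $\delta>0$, a sequence $(x_n)$ in a normed space is symmetrically $(\delta+)$-separated if $\|x_n\pm x_k\|>\delta$ (both signs) for all $n\neq k$. Here "$(1+)$" means $\delta=1$ with strict inequality. *)

theory Defs
  imports Complex_Main
begin

text \<open>
  A norm on \<open>'a\<close> together with a scalar multiplication by \<open>'k\<close>. By Gelfand--Mazur, a type of
  class \<^class>\<open>real_normed_field\<close> is (a copy of) the real or the complex numbers, so \<open>'k = real\<close> and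
  \<open>'k = complex\<close> are the only cases. The class \<^class>\<open>real_normed_vector\<close> already carries the
  real scalar multiplication; \<open>scale_of_real\<close> makes \<open>scale\<close> extend it.
\<close>

locale normed_space_over = vector_space scale
  for scale :: "'k::real_normed_field \<Rightarrow> 'a::real_normed_vector \<Rightarrow> 'a" +
  assumes scale_of_real: "scale (of_real r) x = r *\<^sub>R x"
    and norm_scale: "norm (scale c x) = norm c * norm x"

lemma normed_space_over_scaleR:
  "normed_space_over ((*\<^sub>R) :: real \<Rightarrow> 'a::real_normed_vector \<Rightarrow> 'a)"
  by unfold_locales (simp_all add: algebra_simps)

lemma normed_space_over_complex: "normed_space_over ((*) :: complex \<Rightarrow> complex \<Rightarrow> complex)"
  by unfold_locales (simp_all add: algebra_simps scaleR_conv_of_real norm_mult)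

definition infinite_dimensional :: "('k::field \<Rightarrow> 'a::ab_group_add \<Rightarrow> 'a) \<Rightarrow> bool" where
  "infinite_dimensional scale \<longleftrightarrow> (\<nexists>B. finite_dimensional_vector_space scale B)"

definition symmetrically_plus_separated :: "real \<Rightarrow> (nat \<Rightarrow> 'a::real_normed_vector) \<Rightarrow> bool" where
  "symmetrically_plus_separated \<delta> x \<longleftrightarrow>
     (\<forall>n k. n \<noteq> k \<longrightarrow> norm (x n + x k) > \<delta> \<and> norm (x n - x k) > \<delta>)"

end

theory Submission
  imports Defs
begin

text \<open>
  Call a unit vector \<open>x\<close> of an infinite-dimensional subspace \<open>Z\<close> good if \<open>\<parallel>x + y\<parallel> > 1\<close> for all unit
  vectors \<open>y\<close> of some infinite-dimensional subspace of \<open>Z\<close>. If every \<open>Z\<close> has a good vector,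
  iterating gives the sequence.

  Otherwise fix \<open>Z\<close> without good vectors. Starting from \<open>s\<^sub>0\<close> of norm \<open>3/4\<close>, choose unit vectors
  \<open>w\<^sub>n\<close> in infinite-dimensional subspaces \<open>Y\<^sub>n\<close>, where \<open>Y\<^sub>0\<close> is Birkhoff orthogonal to \<open>s\<^sub>0\<close> and
  \<open>Y\<^sub>n\<^sub>+\<^sub>1 \<subseteq> Y\<^sub>n\<close> to \<open>w\<^sub>n\<close>, with \<open>\<parallel>s\<^sub>n - w\<^sub>n\<parallel> \<le> 1\<close>, and put \<open>s\<^sub>n\<^sub>+\<^sub>1 = s\<^sub>n + t\<^sub>n w\<^sub>n\<close>, where the small
  \<open>t\<^sub>n > 0\<close> keep the \<open>s\<^sub>n\<close> in the unit ball. By continuity \<open>x\<^sub>n = s\<^sub>n - a\<^sub>n w\<^sub>n\<close> is a unit vector for some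
  \<open>a\<^sub>n \<ge> 1\<close>. For \<open>m > n\<close> the vector \<open>x\<^sub>m - x\<^sub>n\<close> lies in \<open>(t\<^sub>n + a\<^sub>n) w\<^sub>n + Y\<^sub>n\<^sub>+\<^sub>1\<close> and \<open>x\<^sub>m + x\<^sub>n\<close> in
  \<open>2 s\<^sub>0 + Y\<^sub>0\<close>, so their norms are at least \<open>t\<^sub>n + a\<^sub>n > 1\<close> and \<open>3/2\<close>.
\<close>

section \<open>Real infinite-dimensional subspaces and Birkhoff orthogonality\<close>

text \<open>Real spans are used even for complex scalars: the construction needs only the real
  structure.\<close>

definition infinite_dim :: "'a::real_vector set \<Rightarrow> bool" where
  "infinite_dim Z \<longleftrightarrow> (\<nexists>B. finite B \<and> Z \<subseteq> span B)"

text \<open>Birkhoff orthogonality of \<open>w\<close> to \<open>M\<close>, a relation that is not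
  symmetric in general.\<close>

definition orthogonal_to :: "'a::real_normed_vector \<Rightarrow> 'a set \<Rightarrow> bool" where
  "orthogonal_to w M \<longleftrightarrow> (\<forall>y\<in>M. norm w \<le> norm (w + y))"

text \<open>A finite set spanning over the reals also spans over \<open>'k\<close>, since
  \<open>'k\<close>-subspaces are real subspaces; thinning it to an independent set would give a
  finite basis.\<close>

lemma infinite_dimensional_imp_infinite_dim:
  fixes scale :: "'k::real_normed_field \<Rightarrow> 'a::real_normed_vector \<Rightarrow> 'a"
  assumes "normed_space_over scale" "infinite_dimensional scale"
  shows "infinite_dim (UNIV :: 'a set)"
  unfolding infinite_dim_def
proof
  interpret normed_space_over scale by fact
  assume "\<exists>B. finite B \<and> (UNIV :: 'a set) \<subseteq> Real_Vector_Spaces.span B"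
  then obtain B :: "'a set" where B: "finite B" "Real_Vector_Spaces.span B = UNIV" by auto
  have "Real_Vector_Spaces.subspace (span B)"
    unfolding Real_Vector_Spaces.subspace_def
    by (metis scale_of_real span_add span_scale span_zero)
  then have "Real_Vector_Spaces.span B \<subseteq> span B"
    by (intro Real_Vector_Spaces.span_minimal) (auto simp: span_superset)
  with B have sp: "span B = UNIV" by auto
  obtain C where C: "C \<subseteq> B" "independent C" "B \<subseteq> span C"
    using maximal_independent_subset[of B] by blast
  have "span C = UNIV" using C(3) sp span_minimal[OF C(3)] subspace_span by auto
  then have "finite_dimensional_vector_space scale C"
    using C B finite_subset by unfold_locales auto
  then show False using assms(2) unfolding infinite_dimensional_def by blast
qed

lemma infinite_dim_unit_vector:
  fixes Z :: "'a::real_normed_vector set"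
  assumes "infinite_dim Z" "subspace Z"
  obtains x where "x \<in> Z" "norm x = 1"
proof -
  have "\<not> Z \<subseteq> span {}" using assms(1) unfolding infinite_dim_def by blast
  then obtain z where z: "z \<in> Z" "z \<noteq> 0" by auto
  show thesis
    by (rule that[of "z /\<^sub>R norm z"]) (use z assms(2) in \<open>auto simp: subspace_scale\<close>)
qed

text \<open>Modulo multiples of \<open>w\<close>, every vector of \<open>Y\<close> lies in
  \<open>Y \<inter> M\<close>, so a finite spanning set of the intersection together with
  \<open>w\<close> would span \<open>Y\<close>.\<close>

lemma infinite_dim_Int_hyperplane:
  assumes Y: "infinite_dim Y" "subspace Y" and w: "w \<in> Y" and M: "\<And>z. \<exists>c. z - c *\<^sub>R w \<in> M"
  shows "infinite_dim (Y \<inter> M)"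
  unfolding infinite_dim_def
proof
  assume "\<exists>B. finite B \<and> Y \<inter> M \<subseteq> span B"
  then obtain B where B: "finite B" "Y \<inter> M \<subseteq> span B" by blast
  have "z \<in> span (insert w B)" if "z \<in> Y" for z
  proof -
    obtain c where "z - c *\<^sub>R w \<in> M" using M by blast
    then have "z - c *\<^sub>R w \<in> span B" using B that w Y(2) by (auto simp: subspace_diff subspace_scale)
    then show ?thesis using span_breakdown_eq by blast
  qed
  then show False using Y(1) B(1) unfolding infinite_dim_def by (metis finite_insert subsetI)
qed

lemma orthogonal_to_norm_ge:
  assumes "orthogonal_to w M" "subspace M" "y \<in> M"
  shows "a * norm w \<le> norm (a *\<^sub>R w + y)"
proof (cases "a > 0")
  case True
  have "norm w \<le> norm (w + y /\<^sub>R a)" using assms by (auto simp: orthogonal_to_def subspace_scale)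
  then have "a * norm w \<le> a * norm (w + y /\<^sub>R a)" using True by simp
  also have "\<dots> = norm (a *\<^sub>R (w + y /\<^sub>R a))" using True by simp
  finally show ?thesis using True by (simp add: scaleR_add_right)
next
  case False
  then have "a * norm w \<le> 0" by (simp add: mult_nonpos_nonneg)
  then show ?thesis using norm_ge_zero[of "a *\<^sub>R w + y"] by linarith
qed

section \<open>Norming hyperplanes\<close>

text \<open>The one-dimensional extension step of Hahn-Banach: \<open>c\<close> is the value at
  \<open>z\<close> of a norm-one functional that is 1 at \<open>w\<close> and 0 on
  \<open>M\<close>.\<close>

lemma orthogonal_to_span_insert:
  assumes M: "orthogonal_to w M" "subspace M" and w: "norm w = 1"
  shows "\<exists>c. orthogonal_to w (span (insert (z - c *\<^sub>R w) M))"
proof -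
  define A where "A = {a - norm (y + a *\<^sub>R w - z) | y a. y \<in> M}"
  \<comment> \<open>Lower bounds for \<open>c\<close> stay below upper bounds: \<open>z\<close>
    cancels in the sum of the two vectors, and orthogonality bounds that sum from below.\<close>
  have le: "a - norm (y + a *\<^sub>R w - z) \<le> norm (y' + a' *\<^sub>R w + z) - a'"
    if "y \<in> M" "y' \<in> M" for y y' a a'
  proof -
    have "a + a' \<le> norm ((a + a') *\<^sub>R w + (y + y'))"
      using orthogonal_to_norm_ge[OF M, of "y + y'" "a + a'"] that M(2) w by (simp add: subspace_add)
    also have "(a + a') *\<^sub>R w + (y + y') = (y + a *\<^sub>R w - z) + (y' + a' *\<^sub>R w + z)"
      by (simp add: algebra_simps)
    also have "norm \<dots> \<le> norm (y + a *\<^sub>R w - z) + norm (y' + a' *\<^sub>R w + z)"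
      by (rule norm_triangle_ineq)
    finally show ?thesis by simp
  qed
  have zM: "0 \<in> M" using M(2) subspace_0 by blast
  have ne: "A \<noteq> {}" unfolding A_def using zM by auto
  have bd: "bdd_above A"
    unfolding A_def by (rule bdd_aboveI[of _ "norm (0 + 0 *\<^sub>R w + z) - 0"]) (use le zM in blast)
  define c where "c = Sup A"
  have low: "a - c \<le> norm (y + a *\<^sub>R w - z)" if "y \<in> M" for y a
  proof -
    have "a - norm (y + a *\<^sub>R w - z) \<in> A" unfolding A_def using that by blast
    then have "a - norm (y + a *\<^sub>R w - z) \<le> c" unfolding c_def using bd by (rule cSup_upper)
    then show ?thesis by simp
  qed
  have up: "a + c \<le> norm (y + a *\<^sub>R w + z)" if "y \<in> M" for y a
  proof -
    have "c \<le> norm (y + a *\<^sub>R w + z) - a"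
      unfolding c_def using ne by (rule cSup_least) (use le that in \<open>auto simp: A_def\<close>)
    then show ?thesis by simp
  qed
  have "norm w \<le> norm (w + v)" if v: "v \<in> span (insert (z - c *\<^sub>R w) M)" for v
  proof -
    obtain t where "v - t *\<^sub>R (z - c *\<^sub>R w) \<in> span M" using v by (auto simp: span_breakdown_eq)
    then have "v - t *\<^sub>R (z - c *\<^sub>R w) \<in> M" using M(2) by (metis span_eq_iff)
    then obtain y where y: "y \<in> M" "v = y + t *\<^sub>R (z - c *\<^sub>R w)" by (metis diff_add_cancel)
    \<comment> \<open>Dividing by the absolute value of \<open>t\<close> reduces to coefficient 1 or
      -1 at \<open>z\<close>, that is, to \<open>up\<close> or \<open>low\<close>.\<close>
    consider "t = 0" | "t > 0" | "t < 0" by linarith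
    then show ?thesis
    proof cases
      case 1
      then show ?thesis using y M(1) by (simp add: orthogonal_to_def)
    next
      case 2
      have "w + v = t *\<^sub>R (y /\<^sub>R t + (1 / t - c) *\<^sub>R w + z)"
        using 2 y by (simp add: algebra_simps)
      then have "norm (w + v) = t * norm (y /\<^sub>R t + (1 / t - c) *\<^sub>R w + z)" using 2 by simp
      moreover have "t * (1 / t) \<le> t * norm (y /\<^sub>R t + (1 / t - c) *\<^sub>R w + z)"
        using up[of "y /\<^sub>R t" "1 / t - c"] 2 y M(2) by (intro mult_left_mono) (auto simp: subspace_scale)
      ultimately show ?thesis using 2 w by simp
    next
      case 3
      define r where "r = - t"
      have r: "r > 0" "t = - r" using 3 by (auto simp: r_def)
      have "w + v = r *\<^sub>R (y /\<^sub>R r + (1 / r + c) *\<^sub>R w - z)"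
        using r y by (simp add: algebra_simps)
      then have "norm (w + v) = r * norm (y /\<^sub>R r + (1 / r + c) *\<^sub>R w - z)" using r by simp
      moreover have "r * (1 / r) \<le> r * norm (y /\<^sub>R r + (1 / r + c) *\<^sub>R w - z)"
        using low[of "y /\<^sub>R r" "1 / r + c"] r y M(2) by (intro mult_left_mono) (auto simp: subspace_scale)
      ultimately show ?thesis using r w by simp
    qed
  qed
  then show ?thesis unfolding orthogonal_to_def by blast
qed

lemma subspace_Union_chain:
  assumes "\<C> \<noteq> {}" "\<And>M. M \<in> \<C> \<Longrightarrow> subspace M" "\<And>M N. M \<in> \<C> \<Longrightarrow> N \<in> \<C> \<Longrightarrow> M \<subseteq> N \<or> N \<subseteq> M"
  shows "subspace (\<Union>\<C>)"
  unfolding subspace_def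
proof (intro conjI ballI allI)
  show "0 \<in> \<Union>\<C>" using assms(1,2) subspace_0 by blast
  show "c *\<^sub>R x \<in> \<Union>\<C>" if "x \<in> \<Union>\<C>" for c x using that assms(2) subspace_scale by blast
  fix x y assume "x \<in> \<Union>\<C>" "y \<in> \<Union>\<C>"
  then obtain M where "M \<in> \<C>" "x \<in> M" "y \<in> M" using assms(3) by blast
  then show "x + y \<in> \<Union>\<C>" using assms(2) subspace_add by blast
qed

text \<open>The Hahn--Banach theorem: \<open>M\<close> is the kernel of a norming functional of \<open>w\<close>.\<close>

lemma orthogonal_hyperplane:
  fixes w :: "'a::real_normed_vector"
  assumes w: "norm w = 1"
  obtains M where "subspace M" "orthogonal_to w M" "\<And>z. \<exists>c. z - c *\<^sub>R w \<in> M"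
proof -
  define \<A> where "\<A> = {M. subspace M \<and> orthogonal_to w M}"
  have "\<exists>M\<in>\<A>. \<forall>N\<in>\<A>. M \<subseteq> N \<longrightarrow> N = M"
  proof (rule subset_Zorn_nonempty)
    have "{0} \<in> \<A>" by (simp add: \<A>_def orthogonal_to_def)
    then show "\<A> \<noteq> {}" by blast
    fix \<C> assume "\<C> \<noteq> {}" "subset.chain \<A> \<C>"
    then have "subspace (\<Union>\<C>)"
      by (intro subspace_Union_chain) (auto simp: subset.chain_def \<A>_def)
    moreover have "orthogonal_to w (\<Union>\<C>)"
      using \<open>subset.chain \<A> \<C>\<close> by (auto simp: subset.chain_def \<A>_def orthogonal_to_def)
    ultimately show "\<Union>\<C> \<in> \<A>" by (simp add: \<A>_def)
  qed
  then obtain M where M: "subspace M" "orthogonal_to w M"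
    and max: "\<And>N. subspace N \<Longrightarrow> orthogonal_to w N \<Longrightarrow> M \<subseteq> N \<Longrightarrow> N = M"
    by (auto simp: \<A>_def)
  have "\<exists>c. z - c *\<^sub>R w \<in> M" for z
  proof -
    obtain c where c: "orthogonal_to w (span (insert (z - c *\<^sub>R w) M))"
      using orthogonal_to_span_insert[OF M(2,1) w] by blast
    have "insert (z - c *\<^sub>R w) M \<subseteq> span (insert (z - c *\<^sub>R w) M)" by (rule span_superset)
    \<comment> \<open>Maximality: the enlarged subspace is still orthogonal, so it already equals
      \<open>M\<close>.\<close>
    moreover from this have "span (insert (z - c *\<^sub>R w) M) = M" using c by (intro max) auto
    ultimately show ?thesis by blast
  qed
  then show thesis using that M by blast
qed

lemma infinite_dim_orthogonal_subspace:
  fixes w :: "'a::real_normed_vector"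
  assumes "infinite_dim Y" "subspace Y" "w \<in> Y" "norm w = 1"
  obtains Y' where "infinite_dim Y'" "subspace Y'" "Y' \<subseteq> Y" "orthogonal_to w Y'"
proof -
  obtain M where M: "subspace M" "orthogonal_to w M" "\<And>z. \<exists>c. z - c *\<^sub>R w \<in> M"
    using orthogonal_hyperplane[OF assms(4)] by blast
  show thesis
  proof (rule that)
    show "infinite_dim (Y \<inter> M)" using infinite_dim_Int_hyperplane assms M(3) by blast
    show "subspace (Y \<inter> M)" using assms M by (simp add: subspace_inter)
    show "orthogonal_to w (Y \<inter> M)" using M(2) by (auto simp: orthogonal_to_def)
  qed auto
qed

section \<open>The case of good vectors in every subspace\<close>

text \<open>The plus sign suffices, because \<open>Y\<close> is closed under negation.\<close>

definition good_pair :: "'a::real_normed_vector set \<Rightarrow> 'a \<Rightarrow> 'a set \<Rightarrow> bool" where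
  "good_pair Z x Y \<longleftrightarrow> x \<in> Z \<and> norm x = 1 \<and> Y \<subseteq> Z \<and> subspace Y \<and> infinite_dim Y \<and>
     (\<forall>y\<in>Y. norm y = 1 \<longrightarrow> norm (x + y) > 1)"

lemma symmetrically_plus_separatedI:
  fixes x :: "nat \<Rightarrow> 'a::real_normed_vector"
  assumes "\<And>n m. n < m \<Longrightarrow> norm (x m + x n) > \<delta> \<and> norm (x m - x n) > \<delta>"
  shows "symmetrically_plus_separated \<delta> x"
  unfolding symmetrically_plus_separated_def
proof (intro allI impI)
  fix n k :: nat assume "n \<noteq> k"
  then consider "n < k" | "k < n" by linarith
  then show "norm (x n + x k) > \<delta> \<and> norm (x n - x k) > \<delta>"
    using assms[of n k] assms[of k n] by cases (simp_all add: add.commute norm_minus_commute)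
qed

lemma separated_sequence_of_good_pairs:
  assumes good: "\<And>Z :: 'a::real_normed_vector set. subspace Z \<Longrightarrow> infinite_dim Z \<Longrightarrow> \<exists>x Y. good_pair Z x Y"
    and inf: "infinite_dim (UNIV :: 'a set)"
  shows "\<exists>x :: nat \<Rightarrow> 'a. (\<forall>n. norm (x n) = 1) \<and> symmetrically_plus_separated 1 x"
proof -
  \<comment> \<open>Each pair is chosen inside the subspace of the previous one; the first conjunct
    keeps that subspace infinite-dimensional, so the choice can continue.\<close>
  have "\<exists>p. \<forall>n. (\<exists>Z. good_pair Z (fst (p n)) (snd (p n :: 'a \<times> 'a set))) \<and>
      good_pair (snd (p n)) (fst (p (Suc n))) (snd (p (Suc n)))"
  proof (rule dependent_nat_choice)
    show "\<exists>p :: 'a \<times> 'a set. \<exists>Z. good_pair Z (fst p) (snd p)"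
      using good[of UNIV] inf by auto
    fix p :: "'a \<times> 'a set" and n :: nat
    assume "\<exists>Z. good_pair Z (fst p) (snd p)"
    then obtain x Y where "good_pair (snd p) x Y"
      using good[of "snd p"] by (auto simp: good_pair_def)
    then show "\<exists>q. (\<exists>Z. good_pair Z (fst q) (snd q)) \<and> good_pair (snd p) (fst q) (snd q)"
      by (intro exI[of _ "(x, Y)"]) auto
  qed
  then obtain p where p: "\<And>n. \<exists>Z. good_pair Z (fst (p n)) (snd (p n :: 'a \<times> 'a set))"
      "\<And>n. good_pair (snd (p n)) (fst (p (Suc n))) (snd (p (Suc n)))"
    by blast
  define x where "x = fst \<circ> p"
  define Y where "Y = snd \<circ> p"
  have nx: "norm (x n) = 1" for n using p(1)[of n] by (auto simp: good_pair_def x_def)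
  have sep: "norm (x n + y) > 1" if "y \<in> Y n" "norm y = 1" for n y
    using p(1)[of n] that by (auto simp: good_pair_def x_def Y_def)
  have sub: "subspace (Y n)" for n using p(1)[of n] by (auto simp: good_pair_def Y_def)
  have nxt: "x (Suc n) \<in> Y n" "Y (Suc n) \<subseteq> Y n" for n
    using p(2)[of n] by (auto simp: good_pair_def x_def Y_def)
  have mem: "x m \<in> Y n" if nm: "n < m" for n m
  proof -
    obtain k where k: "m = Suc k" using nm by (cases m) auto
    have "Y k \<subseteq> Y n" by (rule lift_Suc_antimono_le[of Y]) (use nm k nxt in auto)
    then show ?thesis using nxt(1)[of k] k by blast
  qed
  have "symmetrically_plus_separated 1 x"
  proof (rule symmetrically_plus_separatedI)
    fix n m :: nat assume "n < m"
    then have "x m \<in> Y n" "- x m \<in> Y n" using mem sub by (auto simp: subspace_neg)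
    then show "norm (x m + x n) > 1 \<and> norm (x m - x n) > 1"
      using sep[of "x m" n] sep[of "- x m" n] nx by (simp add: add.commute norm_minus_commute)
  qed
  with nx show ?thesis by blast
qed

section \<open>The case of a subspace without good vectors\<close>

lemma bad_subspace_step:
  fixes Z :: "'a::real_normed_vector set"
  assumes bad: "\<nexists>x Y. good_pair Z x Y" and Z: "subspace Z" "s \<in> Z" "norm s \<le> 1"
    and Y: "Y \<subseteq> Z" "subspace Y" "infinite_dim Y"
  shows "\<exists>w a. w \<in> Y \<and> norm w = 1 \<and> a \<ge> 1 \<and> norm (s - a *\<^sub>R w) = 1"
proof -
  obtain w where w: "w \<in> Y" "norm w = 1" "norm (s - w) \<le> 1"
  proof (cases "s = 0")
    case True
    then show ?thesis using that infinite_dim_unit_vector[OF Y(3,2)] by auto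
  next
    case False
    define u where "u = s /\<^sub>R norm s"
    have u: "u \<in> Z" "norm u = 1" using Z False by (auto simp: u_def subspace_scale)
    have "\<exists>y\<in>Y. norm y = 1 \<and> norm (u + y) \<le> 1"
      using bad u Y unfolding good_pair_def by (metis not_le)
    then obtain y where y: "y \<in> Y" "norm y = 1" "norm (u + y) \<le> 1" by blast
    \<comment> \<open>As \<open>norm s \<le> 1\<close>, this is a convex combination of two vectors
      of the unit ball.\<close>
    have "s + y = norm s *\<^sub>R (u + y) + (1 - norm s) *\<^sub>R y"
      using False by (simp add: u_def algebra_simps)
    then have "norm (s + y) \<le> norm s * norm (u + y) + (1 - norm s) * norm y"
      using norm_triangle_ineq[of "norm s *\<^sub>R (u + y)" "(1 - norm s) *\<^sub>R y"] Z(3) by simp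
    also have "\<dots> \<le> norm s * 1 + (1 - norm s) * 1"
      using y Z(3) by (intro add_mono mult_left_mono) auto
    finally show ?thesis using y Y(2) by (intro that[of "- y"]) (auto simp: subspace_neg)
  qed
  \<comment> \<open>At \<open>a = 1\<close> the norm is at most 1 by the choice of \<open>w\<close>;
    at \<open>a = 2\<close> it is at least \<open>2 - norm s\<close>.\<close>
  have "\<exists>a. 1 \<le> a \<and> a \<le> 2 \<and> norm (s - a *\<^sub>R w) = 1"
  proof (rule IVT')
    have "2 \<le> norm (s - 2 *\<^sub>R w) + norm s"
      using norm_triangle_ineq4[of "s - 2 *\<^sub>R w" s] w by simp
    then show "1 \<le> norm (s - 2 *\<^sub>R w)" using Z(3) by simp
    show "continuous_on {1..2} (\<lambda>a. norm (s - a *\<^sub>R w))" by (intro continuous_intros)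
  qed (use w in auto)
  with w show ?thesis by blast
qed

lemma separated_sequence_of_bad_subspace:
  fixes Z :: "'a::real_normed_vector set"
  assumes bad: "\<nexists>x Y. good_pair Z x Y" and Z: "subspace Z" "infinite_dim Z"
  shows "\<exists>x :: nat \<Rightarrow> 'a. (\<forall>n. norm (x n) = 1) \<and> symmetrically_plus_separated 1 x"
proof -
  obtain x0 where x0: "x0 \<in> Z" "norm x0 = 1" using infinite_dim_unit_vector[OF Z(2,1)] by blast
  obtain Y0 where Y0: "infinite_dim Y0" "subspace Y0" "Y0 \<subseteq> Z" "orthogonal_to x0 Y0"
    using infinite_dim_orthogonal_subspace[OF Z(2,1) x0] by blast
  \<comment> \<open>The factor exceeds 1/2, so that \<open>s0 + s0\<close> has norm above 1, and
    leaves room 1/4 in the unit ball, which is the sum of all \<open>t n\<close>.\<close>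
  define s0 where "s0 = (3/4) *\<^sub>R x0"
  define t :: "nat \<Rightarrow> real" where "t n = (1/2) ^ n / 8" for n
  \<comment> \<open>The reserve \<open>2 * t n\<close> is the sum of \<open>t k\<close> over
    \<open>k \<ge> n\<close>, the total length of the remaining increments of
    \<open>s\<close>.\<close>
  define Inv where "Inv n s w a Y \<longleftrightarrow> infinite_dim Y \<and> subspace Y \<and> Y \<subseteq> Y0 \<and>
      s - s0 \<in> Y0 \<and> norm s \<le> 1 - 2 * t n \<and>
      w \<in> Y \<and> norm w = 1 \<and> 1 \<le> a \<and> norm (s - a *\<^sub>R w) = 1" for n s w a Y
  have t: "t n > 0" "t (Suc n) = t n / 2" for n by (auto simp: t_def)
  have step: "\<exists>w a. Inv n s w a Y"
    if "infinite_dim Y" "subspace Y" "Y \<subseteq> Y0" "s - s0 \<in> Y0" "norm s \<le> 1 - 2 * t n" for n s Y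
  proof -
    have "s0 \<in> Z" using x0 Z by (simp add: s0_def subspace_scale)
    moreover have "s - s0 \<in> Z" using that Y0 by blast
    ultimately have "s \<in> Z" using subspace_add[OF Z(1), of "s - s0" s0] by simp
    then have "\<exists>w a. w \<in> Y \<and> norm w = 1 \<and> a \<ge> 1 \<and> norm (s - a *\<^sub>R w) = 1"
      using that Y0 t[of n] by (intro bad_subspace_step[OF bad Z(1)]) auto
    then show ?thesis using that unfolding Inv_def by blast
  qed
  define J where "J n = (\<lambda>(s, w, a, Y). Inv n s w a Y)" for n
  define R where "R n = (\<lambda>(s, w, a :: real, Y :: 'a set) (s', w' :: 'a, a' :: real, Y').
      s' = s + t n *\<^sub>R w \<and> Y' \<subseteq> Y \<and> orthogonal_to w Y')" for n
  have "\<exists>p. \<forall>n. J n (p n) \<and> R n (p n) (p (Suc n))"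
  proof (rule dependent_nat_choice)
    have "\<exists>w a. Inv 0 s0 w a Y0"
      using Y0 x0 by (intro step) (auto simp: s0_def t_def subspace_0)
    then show "\<exists>q. J 0 q" unfolding J_def by auto
    fix q n assume q: "J n q"
    obtain s w a Y where [simp]: "q = (s, w, a, Y)" by (cases q) auto
    have I: "Inv n s w a Y" using q by (simp add: J_def)
    then obtain Y' where Y': "infinite_dim Y'" "subspace Y'" "Y' \<subseteq> Y" "orthogonal_to w Y'"
      using infinite_dim_orthogonal_subspace[of Y w] unfolding Inv_def by blast
    have "\<exists>w' a'. Inv (Suc n) (s + t n *\<^sub>R w) w' a' Y'"
    proof (rule step)
      have "(s - s0) + t n *\<^sub>R w \<in> Y0"
        using I Y0 by (intro subspace_add subspace_scale) (auto simp: Inv_def)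
      then show "s + t n *\<^sub>R w - s0 \<in> Y0" by (simp add: algebra_simps)
      have "norm (s + t n *\<^sub>R w) \<le> norm s + t n"
        using norm_triangle_ineq[of s "t n *\<^sub>R w"] I t(1)[of n] by (simp add: Inv_def)
      then show "norm (s + t n *\<^sub>R w) \<le> 1 - 2 * t (Suc n)"
        using I by (simp add: Inv_def t(2))
    qed (use Y' I in \<open>auto simp: Inv_def\<close>)
    then obtain w' a' where "Inv (Suc n) (s + t n *\<^sub>R w) w' a' Y'" by blast
    then show "\<exists>q'. J (Suc n) q' \<and> R n q q'"
      using Y' by (intro exI[of _ "(s + t n *\<^sub>R w, w', a', Y')"]) (simp add: J_def R_def)
  qed
  then obtain p where p: "\<And>n. J n (p n)" "\<And>n. R n (p n) (p (Suc n))" by blast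
  define s where "s n = fst (p n)" for n
  define w where "w n = fst (snd (p n))" for n
  define a where "a n = fst (snd (snd (p n)))" for n
  define Y where "Y n = snd (snd (snd (p n)))" for n
  have I: "Inv n (s n) (w n) (a n) (Y n)" for n
    using p(1)[of n] by (auto simp: J_def s_def w_def a_def Y_def split: prod.splits)
  have R: "s (Suc n) = s n + t n *\<^sub>R w n" "Y (Suc n) \<subseteq> Y n" "orthogonal_to (w n) (Y (Suc n))" for n
    using p(2)[of n] by (auto simp: R_def s_def w_def a_def Y_def split: prod.splits)
  have mono: "Y m \<subseteq> Y n" if "n \<le> m" for n m
    using that by (rule lift_Suc_antimono_le[of Y, rotated]) (auto simp: R)
  have sub: "subspace (Y n)" and wY: "w n \<in> Y n" for n using I[of n] by (auto simp: Inv_def)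
  have s_diff: "s m - s n \<in> Y n" if "n \<le> m" for n m
    using that
  proof (induction m rule: dec_induct)
    case base
    show ?case using sub by (simp add: subspace_0)
  next
    case (step m)
    then have "(s m - s n) + t m *\<^sub>R w m \<in> Y n"
      using mono[of n m] wY[of m] sub by (intro subspace_add subspace_scale) auto
    then show ?case by (simp add: R algebra_simps)
  qed
  define x where "x n = s n - a n *\<^sub>R w n" for n
  have x_Y0: "x n - s0 \<in> Y0" for n
  proof -
    have "a n *\<^sub>R w n \<in> Y0" using I[of n] by (intro subspace_scale[OF Y0(2)]) (auto simp: Inv_def)
    then have "(s n - s0) - a n *\<^sub>R w n \<in> Y0"
      using I[of n] unfolding Inv_def by (blast intro: subspace_diff[OF Y0(2)])
    then show ?thesis by (simp add: x_def algebra_simps)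
  qed
  have "symmetrically_plus_separated 1 x"
  proof (rule symmetrically_plus_separatedI, rule conjI)
    fix n m :: nat assume "n < m"
    have "3/2 \<le> norm ((3/2) *\<^sub>R x0 + ((x m - s0) + (x n - s0)))"
      using orthogonal_to_norm_ge[OF Y0(4,2) subspace_add[OF Y0(2) x_Y0 x_Y0], of "3/2" m n] x0
      by simp
    also have "(3/2) *\<^sub>R x0 = s0 + s0" by (simp add: s0_def flip: scaleR_add_left)
    finally show "norm (x m + x n) > 1" by simp
    \<comment> \<open>The comparison starts from \<open>s (Suc n)\<close>: its increment
      \<open>t n\<close> along \<open>w n\<close> makes the coefficient \<open>t n + a n\<close>
      strictly larger than 1, and the rest lies in \<open>Y (Suc n)\<close>, to which
      \<open>w n\<close> is orthogonal.\<close>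
    have "a m *\<^sub>R w m \<in> Y (Suc n)"
      using \<open>n < m\<close> mono[of "Suc n" m] wY[of m] by (intro subspace_scale[OF sub]) auto
    then have "(s m - s (Suc n)) - a m *\<^sub>R w m \<in> Y (Suc n)"
      using \<open>n < m\<close> s_diff[of "Suc n" m] by (simp add: subspace_diff[OF sub])
    from orthogonal_to_norm_ge[OF R(3) sub this, of "t n + a n"]
    have "t n + a n \<le> norm ((t n + a n) *\<^sub>R w n + ((s m - s (Suc n)) - a m *\<^sub>R w m))"
      using I[of n] by (simp add: Inv_def)
    also have "(t n + a n) *\<^sub>R w n + ((s m - s (Suc n)) - a m *\<^sub>R w m) = x m - x n"
      by (simp add: x_def R algebra_simps)
    finally show "norm (x m - x n) > 1" using I[of n] t(1)[of n] by (simp add: Inv_def)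
  qed
  moreover have "norm (x n) = 1" for n using I[of n] by (simp add: Inv_def x_def)
  ultimately show ?thesis by blast
qed

theorem theoremA:
  fixes scale :: "'k::real_normed_field \<Rightarrow> 'a::banach \<Rightarrow> 'a"
  assumes "normed_space_over scale"
    and "infinite_dimensional scale"
  shows "\<exists>x :: nat \<Rightarrow> 'a. (\<forall>n. norm (x n) = 1) \<and> symmetrically_plus_separated 1 x"
proof (cases "\<forall>Z :: 'a set. subspace Z \<longrightarrow> infinite_dim Z \<longrightarrow> (\<exists>x Y. good_pair Z x Y)")
  case True
  then show ?thesis
    using separated_sequence_of_good_pairs infinite_dimensional_imp_infinite_dim[OF assms] by blast
next
  case False
  then show ?thesis using separated_sequence_of_bad_subspace by blast
qed

end
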